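(* If $\mathcal{M}$ is a $\mathcal{C}^1$ convex compact domain of $\mathbb{R}^{n\times n}$, irreducible and with $\rho(\mathcal{M})=0$, then Barabanov balls are strictly convex, i.e. the unit sphere $S=\{x\in\mathbb{R}^n:v(x)=1\}$ of a Barabanov norm $v$ contains no non-trivial segment.
   Context: A $\mathcal{C}^1$ convex compact domain of $\mathbb{R}^{n\times n}$ is a compact convex subset with non-empty interior whose boundary is a $\mathcal{C}^1$ hypersurface (in particular it has exactly one supporting hyperplane at each boundary point). A switching law is a measurable $A:[0,\infty)\to\mathcal{M}$; a solution of the switched system is an absolutely continuous $x:[0,\infty)\to\mathbb{R}^n$ with $\dot x(t)=A(t)x(t)$ a.e. for some switching law. $\mathcal{M}$ is irreducible if no nonzero proper subspace of $\mathbb{R}^n$ is invariant under all $A\in\mathcal{M}$. $\rho(\mathcal{M}):=\sup\limsup_{t\to+\infty}\frac1t\log\|x(t)\|$, supremum over all solutions with $x(0)\ne0$. A Barabanov norm is a norm $v$ on $\mathbb{R}^n$ such that (1) $v(x(t))\le v(x(0))$ for every solution $x(\cdot)$ and $t\ge0$; (2) for every $y\in\mathbb{R}^n$ there is a solution $x(\cdot)$ with $x(0)=y$ and $v(x(t))=v(y)$ for all $t\ge0$. Barabanov balls are the balls of a Barabanov norm. *)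

theory Defs
  imports "HOL-Analysis.Analysis"
begin

text \<open>A \<open>C\<^sup>1\<close> hypersurface is, near each of its points, the zero set of a real-valued \<open>C\<^sup>1\<close> function
  \<open>f\<close> whose gradient \<open>g\<close> does not vanish.\<close>

definition C1_hypersurface :: "'a::euclidean_space set \<Rightarrow> bool" where
  "C1_hypersurface S \<longleftrightarrow>
    (\<forall>p\<in>S. \<exists>U (f :: 'a \<Rightarrow> real) (g :: 'a \<Rightarrow> 'a).
       open U \<and> p \<in> U \<and>
       (\<forall>y\<in>U. (f has_derivative (\<lambda>h. g y \<bullet> h)) (at y)) \<and>
       continuous_on U g \<and> (\<forall>y\<in>U. g y \<noteq> 0) \<and>
       S \<inter> U = {y \<in> U. f y = 0})"

definition C1_convex_compact_domain :: "'a::euclidean_space set \<Rightarrow> bool" where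
  "C1_convex_compact_domain K \<longleftrightarrow>
    compact K \<and> convex K \<and> interior K \<noteq> {} \<and> C1_hypersurface (frontier K)"

text \<open>The usual \<open>\<epsilon>\<close>-\<open>\<delta>\<close> condition: \<open>D\<close> ranges over the finite families of non-overlapping
  compact subintervals \<open>K = {Inf K..Sup K}\<close> of \<open>{a..b}\<close>.\<close>

definition absolutely_continuous_on_interval ::
    "real \<Rightarrow> real \<Rightarrow> (real \<Rightarrow> 'a::real_normed_vector) \<Rightarrow> bool" where
  "absolutely_continuous_on_interval a b f \<longleftrightarrow>
    (\<forall>\<epsilon>>0. \<exists>\<delta>>0. \<forall>D S. D division_of S \<longrightarrow> S \<subseteq> {a..b} \<longrightarrow>
       (\<Sum>K\<in>D. Sup K - Inf K) < \<delta> \<longrightarrow> (\<Sum>K\<in>D. norm (f (Sup K) - f (Inf K))) < \<epsilon>)"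

text \<open>Functions of time have type \<^typ>\<open>real \<Rightarrow> 'a\<close>, but only their values on \<open>{0..}\<close> matter.\<close>

definition switching_law :: "(real^'n^'n) set \<Rightarrow> (real \<Rightarrow> real^'n^'n) \<Rightarrow> bool" where
  "switching_law M A \<longleftrightarrow> A \<in> borel_measurable (lebesgue_on {0..}) \<and> (\<forall>t\<ge>0. A t \<in> M)"

text \<open>Absolute continuity on the unbounded interval \<open>{0..}\<close> is, as usual for differential equations,
  absolute continuity on every compact subinterval.\<close>

definition switched_solution :: "(real^'n^'n) set \<Rightarrow> (real \<Rightarrow> real^'n) \<Rightarrow> bool" where
  "switched_solution M x \<longleftrightarrow>
    (\<forall>T\<ge>0. absolutely_continuous_on_interval 0 T x) \<and>
    (\<exists>A. switching_law M A \<and>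
      (AE t in lebesgue_on {0..}. (x has_vector_derivative A t *v x t) (at t within {0..})))"

definition irreducible_matrices :: "(real^'n^'n) set \<Rightarrow> bool" where
  "irreducible_matrices M \<longleftrightarrow>
    \<not> (\<exists>V. subspace V \<and> V \<noteq> {0} \<and> V \<noteq> UNIV \<and> (\<forall>A\<in>M. \<forall>x\<in>V. A *v x \<in> V))"

text \<open>Solutions with non-zero initial value never vanish, so \<^const>\<open>ln\<close> is only applied to positive
  reals here.\<close>

definition lyapunov_exponent :: "(real^'n^'n) set \<Rightarrow> ereal" where
  "lyapunov_exponent M =
    (SUP x\<in>{x. switched_solution M x \<and> x 0 \<noteq> 0}.
       Limsup at_top (\<lambda>t. ereal (1 / t * ln (norm (x t)))))"

definition is_norm :: "('a::real_vector \<Rightarrow> real) \<Rightarrow> bool" where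
  "is_norm v \<longleftrightarrow>
    (\<forall>x. 0 \<le> v x) \<and> (\<forall>x. v x = 0 \<longleftrightarrow> x = 0) \<and>
    (\<forall>c x. v (c *\<^sub>R x) = \<bar>c\<bar> * v x) \<and> (\<forall>x y. v (x + y) \<le> v x + v y)"

definition barabanov_norm :: "(real^'n^'n) set \<Rightarrow> (real^'n \<Rightarrow> real) \<Rightarrow> bool" where
  "barabanov_norm M v \<longleftrightarrow> is_norm v \<and>
    (\<forall>x t. switched_solution M x \<longrightarrow> 0 \<le> t \<longrightarrow> v (x t) \<le> v (x 0)) \<and>
    (\<forall>y. \<exists>x. switched_solution M x \<and> x 0 = y \<and> (\<forall>t\<ge>0. v (x t) = v y))"

end

theory Submission
  imports Defs
begin

text \<open>Let \<open>y\<close> be the midpoint of a segment \<open>[a, b]\<close> in the unit sphere of \<open>v\<close>. A solution that starts at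
  \<open>y\<close> and stays on the sphere provides, at almost every time \<open>t\<close>, a supporting functional \<open>l\<close> of the
  ball at \<open>x(t)\<close> with \<open>l \<bullet> A(t) x(t) = 0\<close>, because \<open>l \<bullet> x(\<cdot>)\<close> is maximal at \<open>t\<close>. Letting \<open>t \<rightarrow> 0\<close>,
  compactness gives \<open>A \<in> M\<close> and a supporting functional \<open>l\<close> at \<open>y\<close>, hence also at \<open>a\<close> and \<open>b\<close>, with
  \<open>l \<bullet> A y = 0\<close>. Following constant switching laws for a short time shows \<open>l \<bullet> X a \<le> 0\<close> and
  \<open>l \<bullet> X b \<le> 0\<close> for all \<open>X \<in> M\<close>, so \<open>A\<close> maximizes over \<open>M\<close> both linear forms \<open>X \<mapsto> l \<bullet> X a\<close> and
  \<open>X \<mapsto> l \<bullet> X b\<close>. Since \<open>M\<close> has only one normal direction at \<open>A\<close>, these forms are proportional, so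
  \<open>a\<close> and \<open>b\<close> are proportional, and \<open>l \<bullet> a = l \<bullet> b = 1\<close> forces \<open>a = b\<close>.\<close>

subsection \<open>Supporting functionals of norms\<close>

lemma is_norm_le_norm:
  fixes v :: "'a::euclidean_space \<Rightarrow> real"
  assumes "is_norm v"
  obtains C where "C > 0" "\<And>x. v x \<le> C * norm x"
proof
  have sum_le: "v (sum f I) \<le> (\<Sum>i\<in>I. v (f i))" if "finite I" for f :: "'a \<Rightarrow> 'a" and I
    using that
  proof (induction I)
    case empty
    have "v 0 = 0" using assms unfolding is_norm_def by blast
    then show ?case by simp
  next
    case (insert i I)
    have "v (f i + sum f I) \<le> v (f i) + v (sum f I)"
      using assms by (auto simp: is_norm_def)
    with insert show ?case by simp
  qed
  have nonneg: "v x \<ge> 0" for x using assms by (auto simp: is_norm_def)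
  show "(\<Sum>b\<in>Basis. v b) + 1 > 0"
    by (smt (verit) nonneg sum_nonneg)
  fix x :: 'a
  have "v x = v (\<Sum>b\<in>Basis. (x \<bullet> b) *\<^sub>R b)"
    by (simp add: euclidean_representation)
  also have "\<dots> \<le> (\<Sum>b\<in>Basis. v ((x \<bullet> b) *\<^sub>R b))"
    by (rule sum_le) simp
  also have "\<dots> = (\<Sum>b\<in>Basis. \<bar>x \<bullet> b\<bar> * v b)"
    using assms by (simp add: is_norm_def)
  also have "\<dots> \<le> (\<Sum>b\<in>Basis. norm x * v b)"
    by (intro sum_mono mult_right_mono nonneg) (simp add: Basis_le_norm)
  also have "\<dots> \<le> ((\<Sum>b\<in>Basis. v b) + 1) * norm x"
    by (simp add: sum_distrib_left algebra_simps)
  finally show "v x \<le> ((\<Sum>b\<in>Basis. v b) + 1) * norm x" .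
qed

lemma is_norm_continuous_on:
  fixes v :: "'a::euclidean_space \<Rightarrow> real"
  assumes "is_norm v"
  shows "continuous_on S v"
proof -
  obtain C where C: "C > 0" "\<And>x. v x \<le> C * norm x"
    using is_norm_le_norm[OF assms] by blast
  have tri: "v x \<le> v y + v (x - y)" for x y
    using assms unfolding is_norm_def by (metis add.commute diff_add_cancel)
  have sym: "v (x - y) = v (y - x)" for x y
  proof -
    have "v ((- 1) *\<^sub>R (y - x)) = \<bar>- 1\<bar> * v (y - x)"
      using assms unfolding is_norm_def by blast
    then show ?thesis by simp
  qed
  have "dist (v x) (v y) \<le> C * dist x y" for x y
    using tri[of x y] tri[of y x] sym[of x y] C(2)[of "x - y"]
    by (simp add: dist_real_def dist_norm)
  then have "C-lipschitz_on S v"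
    using C by (intro lipschitz_onI) auto
  then show ?thesis
    by (rule lipschitz_on_continuous_on)
qed

text \<open>Separating \<open>y\<close> from the convex open unit ball gives a normal vector
  \<open>a\<close> and a level \<open>b\<close>; dividing \<open>a\<close> by \<open>b\<close>
  normalizes it.\<close>

lemma is_norm_supporting_functional:
  fixes v :: "'a::euclidean_space \<Rightarrow> real"
  assumes v: "is_norm v" and y: "v y = 1"
  obtains l where "l \<bullet> y = 1" "\<And>z. l \<bullet> z \<le> v z"
proof -
  let ?B = "{z. v z < 1}"
  have scale: "v (c *\<^sub>R x) = \<bar>c\<bar> * v x" and tri: "v (x + z) \<le> v x + v z"
    and nonneg: "0 \<le> v x" for c x z
    using v by (auto simp: is_norm_def)
  have "convex ?B"
  proof (rule convexI)
    fix x z :: 'a and a b :: real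
    assume *: "x \<in> ?B" "z \<in> ?B" "0 \<le> a" "0 \<le> b" "a + b = 1"
    have "v (a *\<^sub>R x + b *\<^sub>R z) \<le> a * v x + b * v z"
      using tri[of "a *\<^sub>R x" "b *\<^sub>R z"] * by (simp add: scale)
    also have "\<dots> < 1"
      using * convex_bound_lt[of "v x" 1 "v z" a b] by simp
    finally show "a *\<^sub>R x + b *\<^sub>R z \<in> ?B" by simp
  qed
  have "v 0 = 0"
    using v unfolding is_norm_def by blast
  then have zero: "0 \<in> ?B" by simp
  obtain a b where ab: "a \<noteq> 0" "\<forall>x\<in>?B. a \<bullet> x \<le> b" "a \<bullet> y \<ge> b"
    using separating_hyperplane_sets[of ?B "{y}"] \<open>convex ?B\<close> zero y by auto
  \<comment> \<open>The separation only speaks of the open ball, so homogeneity is used for radii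
    \<open>r\<close> strictly above \<open>v z\<close>; the limit \<open>r\<close> to
    \<open>v z\<close> follows in \<open>le\<close>.\<close>
  have scaled: "a \<bullet> z \<le> b * r" if "v z < r" for z r
  proof -
    have "r > 0" using that nonneg[of z] by linarith
    then have "(1 / r) *\<^sub>R z \<in> ?B" using that by (simp add: scale)
    with ab(2) have "a \<bullet> ((1 / r) *\<^sub>R z) \<le> b" by blast
    then show ?thesis using \<open>r > 0\<close> by (simp add: field_simps)
  qed
  have le: "a \<bullet> z \<le> b * v z" for z
  proof (rule tendsto_lowerbound[of "\<lambda>r. b * r" _ "at_right (v z)"])
    show "((*) b \<longlongrightarrow> b * v z) (at_right (v z))"
      by (intro tendsto_intros)
    show "\<forall>\<^sub>F r in at_right (v z). a \<bullet> z \<le> b * r"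
      using eventually_at_right_less by (rule eventually_mono) (rule scaled)
  qed simp
  \<comment> \<open>Testing \<open>le\<close> with \<open>z = a\<close> shows that \<open>b\<close>
    is positive and may be divided by.\<close>
  have "0 < a \<bullet> a" using ab(1) by simp
  also have "\<dots> \<le> b * v a" by (rule le)
  finally have "b > 0" using nonneg[of a] by (simp add: zero_less_mult_iff)
  have "a \<bullet> y = b" using le[of y] ab(3) y by simp
  show thesis
  proof
    show "(1 / b) *\<^sub>R a \<bullet> y = 1"
      using \<open>b > 0\<close> \<open>a \<bullet> y = b\<close> by simp
    show "(1 / b) *\<^sub>R a \<bullet> z \<le> v z" for z
      using \<open>b > 0\<close> le[of z] by (simp add: field_simps)
  qed
qed

subsection \<open>Normal directions of convex sets with smooth boundary\<close>

text \<open>To first order, \<open>K\<close> at \<open>z\<close> contains every direction of an open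
  half-space bounded by the tangent hyperplane. A functional maximal at \<open>z\<close> is
  nonpositive on that half-space, hence a multiple of its normal, the gradient of the defining
  function.\<close>

lemma C1_convex_compact_domain_normal:
  fixes K :: "'a::euclidean_space set"
  assumes K: "C1_convex_compact_domain K" and z: "z \<in> frontier K"
  obtains g where "\<And>p. \<forall>x\<in>K. p \<bullet> x \<le> p \<bullet> z \<Longrightarrow> \<exists>c. p = c *\<^sub>R g"
proof -
  obtain U f g where U: "open U" "z \<in> U"
    and f: "\<forall>y\<in>U. (f has_derivative (\<lambda>h. g y \<bullet> h)) (at y)"
    and g: "\<forall>y\<in>U. g y \<noteq> (0::'a)" and zeros: "frontier K \<inter> U = {y \<in> U. f y = (0::real)}"
    using K z unfolding C1_convex_compact_domain_def C1_hypersurface_def by blast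
  have "f z = 0" using zeros U z by blast
  have "g z \<noteq> 0" using g U by blast
  have "convex K" "closed K" "interior K \<noteq> {}"
    using K by (auto simp: C1_convex_compact_domain_def compact_imp_closed)
  then have "z \<in> K" using z by (simp add: frontier_def)
  \<comment> \<open>\<open>k\<close> leads from \<open>z\<close> into \<open>K\<close> transversally
    to the tangent hyperplane. If an interior point \<open>w\<close> happens to lie on that
    hyperplane, it is shifted along \<open>g z\<close> within a ball contained in
    \<open>K\<close>.\<close>
  obtain k where k: "z + k \<in> K" "g z \<bullet> k \<noteq> 0"
  proof -
    obtain w where w: "w \<in> interior K" using \<open>interior K \<noteq> {}\<close> by blast
    then obtain e where e: "e > 0" "cball w e \<subseteq> K"
      by (meson mem_interior_cball)
    show thesis
    proof (cases "g z \<bullet> (w - z) = 0")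
      case False
      then show thesis using that[of "w - z"] w interior_subset by fastforce
    next
      case True
      let ?u = "(e / norm (g z)) *\<^sub>R g z"
      have "w + ?u \<in> K"
        using e \<open>g z \<noteq> 0\<close> by (intro subsetD[OF e(2)]) (simp add: dist_norm)
      moreover have "g z \<bullet> (w - z + ?u) \<noteq> 0"
        using True e \<open>g z \<noteq> 0\<close> by (simp add: inner_add_right)
      ultimately show thesis using that[of "w - z + ?u"] by (simp add: algebra_simps)
    qed
  qed
  \<comment> \<open>The sign of \<open>f\<close> inside \<open>K\<close> is not prescribed;
    \<open>s\<close> orients the gradient towards the side of \<open>k\<close>.\<close>
  define s where "s = sgn (g z \<bullet> k)"
  have s: "s * s = 1" "\<bar>s\<bar> = 1" "s * (g z \<bullet> k) > 0"
    using k(2) by (auto simp: s_def sgn_if)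
  text \<open>Near \<open>z\<close> the function \<open>f\<close> has constant sign on the segment from \<open>z + t k\<close> to \<open>z + t h\<close>,
    so that segment does not leave \<open>K\<close>.\<close>
  have inside: "\<exists>t>0. z + t *\<^sub>R h \<in> K" if h: "s * (g z \<bullet> h) > 0" for h
  proof -
    define m where "m = min (s * (g z \<bullet> k)) (s * (g z \<bullet> h))"
    define r where "r = norm h + norm k"
    have "m > 0" using s h by (simp add: m_def)
    have "r > 0" using h by (cases "h = 0") (auto simp: r_def add_pos_nonneg)
    \<comment> \<open>Every \<open>w\<close> on the segment from \<open>k\<close> to
      \<open>h\<close> satisfies \<open>s * (g z \<bullet> w) \<ge> m\<close> and
      \<open>norm w \<le> r\<close>. With this \<open>e\<close> the linearization error at
      \<open>z + t w\<close> is at most \<open>t * m / 2\<close>, too small for \<open>f\<close> to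
      vanish there.\<close>
    define e where "e = m / (2 * r)"
    have "e > 0" using \<open>m > 0\<close> \<open>r > 0\<close> by (simp add: e_def)
    obtain d where d: "d > 0"
        "\<And>y. norm (y - z) < d \<Longrightarrow> norm (f y - f z - g z \<bullet> (y - z)) \<le> e * norm (y - z)"
      using f U \<open>e > 0\<close> unfolding has_derivative_at_alt by meson
    obtain d' where d': "d' > 0" "ball z d' \<subseteq> U"
      using U by (meson open_contains_ball)
    \<comment> \<open>The scaled segment must lie in \<open>U\<close> and where the linearization
      estimate holds; \<open>t \<le> 1\<close> lets convexity put \<open>z + t k\<close> into
      \<open>K\<close>.\<close>
    define t where "t = min 1 (min d d' / (2 * r))"
    have t: "0 < t" "t \<le> 1" "t * r < d" "t * r < d'"
    proof -
      show "0 < t" "t \<le> 1" using d(1) d'(1) \<open>r > 0\<close> by (auto simp: t_def)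
      have "t \<le> min d d' / (2 * r)" by (simp add: t_def)
      then have "t * r \<le> min d d' / 2" using \<open>r > 0\<close> by (simp add: field_simps)
      then show "t * r < d" "t * r < d'" using d(1) d'(1) by auto
    qed
    let ?S = "closed_segment (z + t *\<^sub>R k) (z + t *\<^sub>R h)"
    have "?S \<inter> frontier K = {}"
    proof (rule ccontr)
      assume "?S \<inter> frontier K \<noteq> {}"
      then obtain y where y: "y \<in> ?S" "y \<in> frontier K" by blast
      then obtain u where u: "0 \<le> u" "u \<le> 1"
        "y = (1 - u) *\<^sub>R (z + t *\<^sub>R k) + u *\<^sub>R (z + t *\<^sub>R h)"
        by (auto simp: in_segment)
      define w where "w = (1 - u) *\<^sub>R k + u *\<^sub>R h"
      have yw: "y - z = t *\<^sub>R w" by (simp add: u(3) w_def algebra_simps)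
      have "norm w \<le> (1 - u) * norm k + u * norm h"
        unfolding w_def using u by (intro norm_triangle_le) simp
      also have "\<dots> \<le> 1 * norm k + 1 * norm h"
        using u by (intro add_mono mult_right_mono) auto
      finally have "norm w \<le> r" by (simp add: r_def)
      then have "norm (y - z) \<le> t * r"
        using t(1) by (simp add: yw)
      then have "y \<in> U" and small: "norm (y - z) < d"
        using t d'(2) by (auto simp: dist_norm norm_minus_commute)
      then have "f y = 0" using zeros y by blast
      then have "\<bar>g z \<bullet> (y - z)\<bar> \<le> e * norm (y - z)"
        using d(2)[OF small] \<open>f z = 0\<close> by simp
      also have "\<dots> \<le> e * (t * r)"
        using \<open>norm (y - z) \<le> t * r\<close> \<open>e > 0\<close> by simp
      also have "\<dots> = t * m / 2"
        using \<open>r > 0\<close> by (simp add: e_def)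
      finally have upper: "\<bar>g z \<bullet> (y - z)\<bar> \<le> t * m / 2" .
      have "m = (1 - u) * m + u * m" by (simp add: algebra_simps)
      also have "\<dots> \<le> (1 - u) * (s * (g z \<bullet> k)) + u * (s * (g z \<bullet> h))"
        using u by (intro add_mono mult_left_mono) (auto simp: m_def)
      also have "\<dots> = s * (g z \<bullet> w)"
        by (simp add: w_def inner_add_right algebra_simps)
      also have "\<dots> \<le> \<bar>g z \<bullet> w\<bar>"
        using s(2) by (metis abs_ge_self abs_mult mult_1)
      finally have "t * m \<le> \<bar>g z \<bullet> (y - z)\<bar>"
        using t(1) by (simp add: yw abs_mult)
      with upper have "t * m \<le> 0" by simp
      then show False using t(1) \<open>m > 0\<close> by (simp add: mult_le_0_iff)
    qed
    moreover have "z + t *\<^sub>R k \<in> K"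
    proof -
      have "(1 - t) *\<^sub>R z + t *\<^sub>R (z + k) \<in> K"
        using \<open>convex K\<close> \<open>z \<in> K\<close> k(1) t by (intro convexD) auto
      then show ?thesis by (simp add: algebra_simps)
    qed
    \<comment> \<open>A connected set that meets \<open>K\<close> but not its frontier stays in
      \<open>K\<close>.\<close>
    ultimately have "?S \<subseteq> K"
      using connected_Int_frontier[of ?S K] by (auto simp: ends_in_segment)
    then show ?thesis using t(1) by auto
  qed
  show thesis
  proof
    fix p assume p: "\<forall>x\<in>K. p \<bullet> x \<le> p \<bullet> z"
    have neg: "p \<bullet> h \<le> 0" if h: "s * (g z \<bullet> h) > 0" for h
    proof -
      obtain t where t: "t > 0" "z + t *\<^sub>R h \<in> K" using inside[OF h] by blast
      with p have "p \<bullet> (z + t *\<^sub>R h) \<le> p \<bullet> z" by blast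
      then show ?thesis using t(1) by (simp add: inner_add_right mult_le_0_iff)
    qed
    \<comment> \<open>\<open>w\<close> is the component of \<open>p\<close> orthogonal to
      \<open>g z\<close>. It lies on the boundary of the half-space where \<open>neg\<close>
      applies, so it is pushed inside by \<open>e * s\<close> times \<open>g z\<close> and
      \<open>e\<close> tends to 0.\<close>
    define c where "c = (p \<bullet> g z) / (g z \<bullet> g z)"
    define w where "w = p - c *\<^sub>R g z"
    have "g z \<bullet> w = 0"
      using \<open>g z \<noteq> 0\<close> by (simp add: w_def c_def inner_diff_right inner_commute)
    have "p \<bullet> w = w \<bullet> w"
      using \<open>g z \<bullet> w = 0\<close> by (simp add: w_def inner_diff_left inner_diff_right inner_commute)
    have "p \<bullet> w \<le> 0"
    proof (rule tendsto_upperbound[of "\<lambda>e. p \<bullet> (w + (e * s) *\<^sub>R g z)" _ "at_right 0"])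
      have "((\<lambda>e. p \<bullet> (w + (e * s) *\<^sub>R g z)) \<longlongrightarrow> p \<bullet> (w + (0 * s) *\<^sub>R g z)) (at_right 0)"
        by (intro tendsto_intros)
      then show "((\<lambda>e. p \<bullet> (w + (e * s) *\<^sub>R g z)) \<longlongrightarrow> p \<bullet> w) (at_right 0)" by simp
      have "p \<bullet> (w + (e * s) *\<^sub>R g z) \<le> 0" if "e > 0" for e
      proof (rule neg)
        have "s * (g z \<bullet> (w + (e * s) *\<^sub>R g z)) = e * (s * s) * (g z \<bullet> g z)"
          using \<open>g z \<bullet> w = 0\<close> by (simp add: inner_add_right)
        then show "s * (g z \<bullet> (w + (e * s) *\<^sub>R g z)) > 0"
          using that s(1) \<open>g z \<noteq> 0\<close> by simp
      qed
      then show "\<forall>\<^sub>F e in at_right 0. p \<bullet> (w + (e * s) *\<^sub>R g z) \<le> 0"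
        by (auto simp: eventually_at_right_field intro!: exI[of _ 1])
    qed simp
    then have "w = 0" using \<open>p \<bullet> w = w \<bullet> w\<close> inner_gt_zero_iff[of w] by linarith
    then show "\<exists>c. p = c *\<^sub>R g z" by (auto simp: w_def)
  qed
qed

text \<open>From an interior point a small step along \<open>p\<close> would stay in
  \<open>K\<close> and increase the functional.\<close>

lemma supporting_imp_frontier:
  fixes K :: "'a::euclidean_space set"
  assumes "z \<in> K" "p \<noteq> 0" "\<forall>x\<in>K. p \<bullet> x \<le> p \<bullet> z"
  shows "z \<in> frontier K"
proof -
  have "z \<notin> interior K"
  proof
    assume "z \<in> interior K"
    then obtain e where e: "e > 0" "cball z e \<subseteq> K"
      by (meson mem_interior_cball)
    then have "z + (e / norm p) *\<^sub>R p \<in> K"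
      using assms(2) by (intro subsetD[OF e(2)]) (simp add: dist_norm)
    with assms(3) have "p \<bullet> (z + (e / norm p) *\<^sub>R p) \<le> p \<bullet> z" by blast
    then have "(e / norm p) * (p \<bullet> p) \<le> 0" by (simp add: inner_add_right)
    moreover have "(e / norm p) * (p \<bullet> p) > 0"
      using e(1) assms(2) by (intro mult_pos_pos) auto
    ultimately show False by linarith
  qed
  then show ?thesis
    using assms(1) closure_subset by (auto simp: frontier_def)
qed

subsection \<open>Solutions of the switched system\<close>

text \<open>The solution is the matrix exponential \<open>exp (t A) y\<close>, with
  \<open>P k\<close> the vector \<open>A ^ k y\<close>. It is written coordinate by coordinate so
  that real power series can be differentiated termwise.\<close>

lemma linear_ode_solution_exists:
  fixes A :: "real^'n^'n" and y :: "real^'n"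
  obtains x where "x 0 = y" "\<And>t. (x has_vector_derivative A *v x t) (at t)"
proof -
  define P where "P k = (((*v) A) ^^ k) y" for k
  define x where "x t = (\<chi> i. \<Sum>k. P k $ i / fact k * t ^ k)" for t :: real
  obtain C where C: "C > 0" "\<And>z. norm (A *v z) \<le> norm z * C"
    using bounded_linear.pos_bounded[OF matrix_vector_mul_bounded_linear] by blast
  have P_bound: "norm (P k) \<le> C ^ k * norm y" for k
  proof (induction k)
    case (Suc k)
    have "norm (P (Suc k)) \<le> norm (P k) * C" using C(2) by (simp add: P_def)
    also have "\<dots> \<le> (C ^ k * norm y) * C" using Suc C(1) by (intro mult_right_mono) auto
    finally show ?case by (simp add: algebra_simps)
  qed (simp add: P_def)
  have summ: "summable (\<lambda>k. P k $ i / fact k * t ^ k)" for i and t :: real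
  proof (rule summable_comparison_test)
    have "norm (P k $ i / fact k * t ^ k) \<le> norm y * (inverse (fact k) * (C * \<bar>t\<bar>) ^ k)" for k
    proof -
      have "\<bar>P k $ i\<bar> \<le> C ^ k * norm y"
        using P_bound[of k] component_le_norm_cart[of "P k" i] by linarith
      then have "\<bar>P k $ i\<bar> * (\<bar>t\<bar> ^ k / fact k) \<le> C ^ k * norm y * (\<bar>t\<bar> ^ k / fact k)"
        by (intro mult_right_mono) auto
      then show ?thesis
        by (simp add: abs_mult power_abs power_mult_distrib field_simps)
    qed
    then show "\<exists>N. \<forall>k\<ge>N. norm (P k $ i / fact k * t ^ k) \<le> norm y * (inverse (fact k) * (C * \<bar>t\<bar>) ^ k)"
      by blast
    show "summable (\<lambda>k. norm y * (inverse (fact k) * (C * \<bar>t\<bar>) ^ k))"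
      by (intro summable_mult summable_exp)
  qed
  have diffs_eq: "diffs (\<lambda>k. P k $ i / fact k) = (\<lambda>k. P (Suc k) $ i / fact k)" for i
    by (rule ext) (simp add: diffs_def del: of_nat_Suc)
  have deriv: "((\<lambda>s. x s $ i) has_real_derivative (\<Sum>k. P (Suc k) $ i / fact k * t ^ k)) (at t)"
    for i t
    using termdiffs_strong_converges_everywhere[of "\<lambda>k. P k $ i / fact k" t] summ
    by (simp add: diffs_eq x_def)
  \<comment> \<open>\<open>P (Suc k)\<close> is \<open>A *v P k\<close>, and the finite sum over
    \<open>j\<close> commutes with the convergent series.\<close>
  have ode: "(\<Sum>k. P (Suc k) $ i / fact k * t ^ k) = (A *v x t) $ i" for i t
  proof -
    have "(\<lambda>k. P (Suc k) $ i / fact k * t ^ k) = (\<lambda>k. \<Sum>j\<in>UNIV. A $ i $ j * (P k $ j / fact k * t ^ k))"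
      by (rule ext)
        (simp add: P_def matrix_vector_mult_def sum_divide_distrib sum_distrib_right mult.assoc)
    then have "(\<Sum>k. P (Suc k) $ i / fact k * t ^ k)
        = (\<Sum>k. (\<Sum>j\<in>UNIV. A $ i $ j * (P k $ j / fact k * t ^ k)))" by (rule arg_cong)
    also have "\<dots> = (\<Sum>j\<in>UNIV. (\<Sum>k. A $ i $ j * (P k $ j / fact k * t ^ k)))"
      by (intro suminf_sum summable_mult summ)
    also have "\<dots> = (A *v x t) $ i"
      by (simp only: x_def matrix_vector_mult_def vec_lambda_beta suminf_mult[OF summ])
    finally show ?thesis .
  qed
  show thesis
  proof
    show "x 0 = y"
      by (simp only: x_def powser_zero vec_eq_iff vec_lambda_beta) (simp add: P_def)
    fix t
    have "((\<lambda>s. x s \<bullet> b) has_derivative (\<lambda>h. (h *\<^sub>R (A *v x t)) \<bullet> b)) (at t)"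
      if b: "b \<in> Basis" for b
    proof -
      obtain i where i: "b = axis i 1" using b by (auto simp: Basis_vec_def)
      have "((\<lambda>s. x s $ i) has_vector_derivative (A *v x t) $ i) (at t)"
        using deriv[of i t] unfolding ode by (simp add: has_real_derivative_iff_has_vector_derivative)
      then show ?thesis
        by (simp add: i inner_axis has_vector_derivative_def)
    qed
    then show "(x has_vector_derivative A *v x t) (at t)"
      unfolding has_vector_derivative_def by (subst has_derivative_componentwise_within) auto
  qed
qed

lemma lipschitz_imp_absolutely_continuous_on_interval:
  assumes "L-lipschitz_on {a..b} f"
  shows "absolutely_continuous_on_interval a b f"
  unfolding absolutely_continuous_on_interval_def
proof (intro allI impI)
  fix e :: real assume "e > 0"
  have "L \<ge> 0" using assms by (rule lipschitz_on_nonneg)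
  show "\<exists>d>0. \<forall>D S. D division_of S \<longrightarrow> S \<subseteq> {a..b} \<longrightarrow> (\<Sum>K\<in>D. Sup K - Inf K) < d \<longrightarrow>
      (\<Sum>K\<in>D. norm (f (Sup K) - f (Inf K))) < e"
  \<comment> \<open>Dividing by \<open>L + 1\<close> rather than \<open>L\<close> covers
    \<open>L = 0\<close>.\<close>
  proof (intro exI[of _ "e / (L + 1)"] conjI allI impI)
    show "e / (L + 1) > 0" using \<open>e > 0\<close> \<open>L \<ge> 0\<close> by simp
    fix D S
    assume D: "D division_of S" "S \<subseteq> {a..b}" "(\<Sum>K\<in>D. Sup K - Inf K) < e / (L + 1)"
    have K: "Inf K \<le> Sup K \<and> norm (f (Sup K) - f (Inf K)) \<le> L * (Sup K - Inf K)" if "K \<in> D" for K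
    proof -
      obtain c d where cd: "K = cbox c d" using division_ofD(4)[OF D(1) \<open>K \<in> D\<close>] by blast
      have "K \<noteq> {}" "K \<subseteq> {a..b}" using division_ofD(2,3)[OF D(1) \<open>K \<in> D\<close>] D(2) by auto
      then have "c \<le> d" "c \<in> {a..b}" "d \<in> {a..b}" by (auto simp: cd)
      then show ?thesis
        using lipschitz_onD[OF assms, of d c] by (simp add: cd dist_norm)
    qed
    have "(\<Sum>K\<in>D. norm (f (Sup K) - f (Inf K))) \<le> (\<Sum>K\<in>D. L * (Sup K - Inf K))"
      using K by (intro sum_mono) auto
    also have "\<dots> = L * (\<Sum>K\<in>D. Sup K - Inf K)" by (simp add: sum_distrib_left)
    also have "\<dots> \<le> (L + 1) * (\<Sum>K\<in>D. Sup K - Inf K)"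
      using K by (intro mult_right_mono sum_nonneg) auto
    also have "\<dots> < e" using D(3) \<open>L \<ge> 0\<close> by (simp add: field_simps)
    finally show "(\<Sum>K\<in>D. norm (f (Sup K) - f (Inf K))) < e" .
  qed
qed

text \<open>On a compact interval the derivative \<open>A *v x t\<close> is continuous, hence
  bounded, so \<open>x\<close> is Lipschitz there. These solutions serve as test trajectories for
  the monotonicity of a Barabanov norm.\<close>

lemma switched_solution_constant_law:
  fixes A :: "real^'n^'n"
  assumes "A \<in> M" and deriv: "\<And>t. (x has_vector_derivative A *v x t) (at t)"
  shows "switched_solution M x"
  unfolding switched_solution_def
proof (intro conjI allI impI exI[of _ "\<lambda>_. A"])
  show "switching_law M (\<lambda>_. A)" using assms by (simp add: switching_law_def)
  show "AE t in lebesgue_on {0..}. (x has_vector_derivative A *v x t) (at t within {0..})"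
    using deriv by (intro AE_I2) (blast intro: has_vector_derivative_at_within)
  fix T :: real assume "T \<ge> 0"
  have "continuous_on {0..T} x"
    using deriv by (intro continuous_at_imp_continuous_on)
      (blast intro: has_vector_derivative_continuous)
  then have "continuous_on {0..T} (\<lambda>t. A *v x t)"
    by (intro matrix_vector_mult_linear_continuous_on[THEN continuous_on_compose2]) auto
  then have "bounded ((\<lambda>t. A *v x t) ` {0..T})"
    by (intro compact_imp_bounded compact_continuous_image) auto
  then obtain B where B: "B > 0" "\<And>t. t \<in> {0..T} \<Longrightarrow> norm (A *v x t) \<le> B"
    unfolding bounded_pos by auto
  have "B-lipschitz_on {0..T} x"
  proof (rule bounded_derivative_imp_lipschitz)
    show "(x has_derivative (\<lambda>h. h *\<^sub>R (A *v x t))) (at t within {0..T})" for t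
      using has_vector_derivative_at_within[OF deriv] by (simp add: has_vector_derivative_def)
    show "onorm (\<lambda>h. h *\<^sub>R (A *v x t)) \<le> B" if "t \<in> {0..T}" for t
      using B(2)[OF that] by (intro onorm_le) (simp add: mult.commute[of B] mult_left_mono)
  qed (use B in auto)
  then show "absolutely_continuous_on_interval 0 T x"
    by (rule lipschitz_imp_absolutely_continuous_on_interval)
qed

lemma absolutely_continuous_on_interval_tendsto:
  fixes x :: "real \<Rightarrow> 'a::real_normed_vector"
  assumes x: "absolutely_continuous_on_interval a b x" and "a < b"
  shows "(x \<longlongrightarrow> x a) (at_right a)"
proof (rule tendstoI)
  fix e :: real assume "e > 0"
  then obtain d where d: "d > 0"
    "\<And>D S. D division_of S \<Longrightarrow> S \<subseteq> {a..b} \<Longrightarrow> (\<Sum>K\<in>D. Sup K - Inf K) < d \<Longrightarrow>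
       (\<Sum>K\<in>D. norm (x (Sup K) - x (Inf K))) < e"
    using x unfolding absolutely_continuous_on_interval_def by meson
  have "dist (x t) (x a) < e" if t: "a < t" "t < min b (a + d)" for t
  proof -
    \<comment> \<open>Absolute continuity is applied to the family with the single interval
      \<open>{a..t}\<close>.\<close>
    have "{{a..t}} division_of {a..t}"
      using division_of_self[of a t] t by simp
    from d(2)[OF this] show ?thesis using t by (simp add: dist_norm)
  qed
  then show "\<forall>\<^sub>F t in at_right a. dist (x t) (x a) < e"
    using \<open>d > 0\<close> \<open>a < b\<close>
    by (auto simp: eventually_at_right_field intro!: exI[of _ "min b (a + d)"])
qed

text \<open>A nonempty open interval is not negligible, so it is not covered by the exceptional null
  set.\<close>

lemma AE_lebesgue_on_halfline_obtain:
  assumes "AE t in lebesgue_on {0..}. P t" and "e > (0::real)"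
  obtains t where "0 < t" "t < e" "P t"
proof -
  obtain N where N: "{t \<in> space (lebesgue_on {0..}). \<not> P t} \<subseteq> N"
      "N \<in> null_sets (lebesgue_on {0..})"
    using assms(1) unfolding eventually_ae_filter by blast
  then have "negligible N"
    by (simp add: null_sets_restrict_space negligible_iff_null_sets)
  then have "\<not> {0<..<e} \<subseteq> N"
    using open_not_negligible[of "{0<..<e}"] negligible_subset[of N "{0<..<e}"] assms(2)
    by (metis dense_eq0_I greaterThanLessThan_empty_iff open_greaterThanLessThan linorder_not_less)
  then obtain t where "t \<in> {0<..<e}" "t \<notin> N" by blast
  then have t: "0 < t" "t < e" "t \<notin> N" "0 \<le> t" by auto
  moreover have "{t. 0 \<le> t \<and> \<not> P t} \<subseteq> N" using N(1) by simp
  ultimately have "P t" by blast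
  with t show thesis using that by blast
qed

subsection \<open>Strict convexity of Barabanov balls\<close>

text \<open>Otherwise \<open>l \<bullet> x t\<close>, and with it \<open>v (x t)\<close>, would
  exceed \<open>v y\<close> shortly after time 0 along the constant law \<open>A\<close>, whereas
  \<open>v\<close> does not increase along solutions.\<close>

lemma barabanov_norm_supporting_le:
  fixes A :: "real^'n^'n"
  assumes v: "barabanov_norm M v" and "A \<in> M" and "\<And>z. l \<bullet> z \<le> v z" and "l \<bullet> y = v y"
  shows "l \<bullet> (A *v y) \<le> 0"
proof (rule ccontr)
  assume neg: "\<not> l \<bullet> (A *v y) \<le> 0"
  obtain x where x: "x 0 = y" "\<And>t. (x has_vector_derivative A *v x t) (at t)"
    using linear_ode_solution_exists by blast
  have "((\<lambda>t. l \<bullet> x t) has_real_derivative l \<bullet> (A *v y)) (at 0)"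
    using bounded_linear.has_vector_derivative[OF bounded_linear_inner_right x(2)[of 0], of l] x(1)
    by (simp add: has_real_derivative_iff_has_vector_derivative)
  from DERIV_pos_inc_right[OF this] neg
  obtain d where d: "d > 0" "\<forall>h>0. h < d \<longrightarrow> l \<bullet> x 0 < l \<bullet> x (0 + h)"
    by (auto simp: not_le)
  then have "l \<bullet> x 0 < l \<bullet> x (0 + d / 2)"
    by (metis half_gt_zero_iff field_sum_of_halves less_add_same_cancel1)
  then have "l \<bullet> x 0 < l \<bullet> x (d / 2)" by simp
  also have "\<dots> \<le> v (x (d / 2))" by (rule assms(3))
  also have "\<dots> \<le> v (x 0)"
    using v switched_solution_constant_law[OF \<open>A \<in> M\<close> x(2)] \<open>d > 0\<close>
    by (simp add: barabanov_norm_def)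
  finally show False using x(1) assms(4) by simp
qed

text \<open>An extremal solution from \<open>y\<close> need not be differentiable at time 0, and the
  value of its law there carries no information. The pair is therefore a limit of pairs at good
  times tending to 0.\<close>

lemma barabanov_norm_extremal_pair:
  fixes M :: "(real^'n^'n) set"
  assumes v: "barabanov_norm M v" and "compact M" and y: "v y = 1"
  obtains l A where "\<And>z. l \<bullet> z \<le> v z" "l \<bullet> y = 1" "A \<in> M" "l \<bullet> (A *v y) = 0"
proof -
  have norm: "is_norm v" using v by (simp add: barabanov_norm_def)
  obtain x where x: "switched_solution M x" "x 0 = y" "\<forall>t\<ge>0. v (x t) = v y"
    using v unfolding barabanov_norm_def by blast
  have x_norm: "v (x t) = 1" if "t \<ge> 0" for t
    using x(3) y that by simp
  from x(1) obtain B where B: "switching_law M B"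
    "AE t in lebesgue_on {0..}. (x has_vector_derivative B t *v x t) (at t within {0..})"
    by (auto simp: switched_solution_def)
  \<comment> \<open>All conditions in \<open>Q\<close> are closed, so they survive the passage to
    the limit.\<close>
  define Q where "Q t l = (l \<bullet> x t = 1 \<and> (\<forall>z. l \<bullet> z \<le> v z) \<and> l \<bullet> (B t *v x t) = 0)" for t l
  have "\<exists>t l. 0 < t \<and> t < 1 / real (Suc k) \<and> Q t l" for k
  proof -
    obtain t where t: "0 < t" "t < 1 / real (Suc k)"
      "(x has_vector_derivative B t *v x t) (at t within {0..})"
      using AE_lebesgue_on_halfline_obtain[OF B(2), of "1 / real (Suc k)"] by auto
    obtain l where l: "l \<bullet> x t = 1" "\<And>z. l \<bullet> z \<le> v z"
      using is_norm_supporting_functional[OF norm x_norm[of t]] t(1) by auto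
    \<comment> \<open>As \<open>t\<close> is positive, the derivative is two-sided and vanishes at a
      local maximum; the radius \<open>t\<close> below keeps \<open>s\<close> positive, where
      \<open>v (x s) = 1\<close>.\<close>
    have "at t within {0..} = at t"
      using t(1) by (intro at_within_open_subset[of t "{0<..}"]) auto
    with t(3) have "(x has_vector_derivative B t *v x t) (at t)" by simp
    then have D: "((\<lambda>s. l \<bullet> x s) has_real_derivative l \<bullet> (B t *v x t)) (at t)"
      using bounded_linear.has_vector_derivative[OF bounded_linear_inner_right]
      by (auto simp: has_real_derivative_iff_has_vector_derivative)
    have "l \<bullet> x s \<le> l \<bullet> x t" if "\<bar>t - s\<bar> < t" for s
      using l(1) l(2)[of "x s"] x_norm[of s] that by auto
    then have "l \<bullet> (B t *v x t) = 0"
      by (intro DERIV_local_max[OF D t(1)]) simp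
    then show ?thesis using t l unfolding Q_def by blast
  qed
  then obtain \<tau> \<eta> where \<tau>: "\<And>k. 0 < \<tau> k" "\<And>k. \<tau> k < 1 / real (Suc k)" "\<And>k. Q (\<tau> k) (\<eta> k)"
    by metis
  have \<eta>: "\<eta> k \<bullet> x (\<tau> k) = 1" "\<eta> k \<bullet> z \<le> v z" "\<eta> k \<bullet> (B (\<tau> k) *v x (\<tau> k)) = 0"
    for k z
    using \<tau>(3)[of k] by (simp_all add: Q_def)
  have "\<tau> \<longlonglongrightarrow> 0"
    by (rule real_tendsto_sandwich[OF _ _ tendsto_const LIMSEQ_inverse_real_of_nat])
      (use \<tau> in \<open>auto simp: inverse_eq_divide less_imp_le\<close>)
  moreover have "\<tau> k \<in> {0<..} \<and> \<tau> k \<noteq> 0" for k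
    using \<tau>(1)[of k] by simp
  ultimately have "filterlim \<tau> (at_right 0) sequentially"
    by (simp add: filterlim_at)
  moreover have "(x \<longlongrightarrow> y) (at_right 0)"
    using absolutely_continuous_on_interval_tendsto[of 0 1 x] x(1,2)
    by (simp add: switched_solution_def)
  ultimately have x_lim: "(\<lambda>k. x (\<tau> k)) \<longlonglongrightarrow> y"
    by (rule filterlim_compose[rotated])
  obtain C where C: "C > 0" "\<And>z. v z \<le> C * norm z"
    using is_norm_le_norm[OF norm] by blast
  \<comment> \<open>Testing \<open>\<eta> k\<close> on itself bounds the functionals, so they stay
    in a compact ball.\<close>
  have "norm (\<eta> k) \<le> C" for k
  proof -
    have "norm (\<eta> k) * norm (\<eta> k) = \<eta> k \<bullet> \<eta> k" by (simp add: dot_square_norm power2_eq_square)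
    also have "\<dots> \<le> v (\<eta> k)"
      by (rule \<eta>(2))
    also have "\<dots> \<le> C * norm (\<eta> k)" by (rule C(2))
    finally have le: "norm (\<eta> k) * norm (\<eta> k) \<le> C * norm (\<eta> k)" .
    show ?thesis
    proof (cases "\<eta> k = 0")
      case True
      then show ?thesis using C(1) by simp
    next
      case False
      with le show ?thesis by (intro mult_right_le_imp_le[OF le]) simp
    qed
  qed
  then have range: "\<forall>k. (\<eta> k, B (\<tau> k)) \<in> cball 0 C \<times> M"
    using B(1) \<tau>(1) by (auto simp: switching_law_def less_imp_le)
  \<comment> \<open>Compactness of the product yields one subsequence along which both functionals
    and matrices converge.\<close>
  have "seq_compact (cball (0::real^'n) C \<times> M)"
    using \<open>compact M\<close> by (intro compact_imp_seq_compact compact_Times) auto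
  then obtain w r where "w \<in> cball 0 C \<times> M" and r: "strict_mono (r :: nat \<Rightarrow> nat)"
    and "((\<lambda>k. (\<eta> k, B (\<tau> k))) \<circ> r) \<longlonglongrightarrow> w"
    using range by (rule seq_compactE)
  moreover obtain l A where "w = (l, A)" by (cases w)
  ultimately have lA: "A \<in> M" "((\<lambda>k. (\<eta> k, B (\<tau> k))) \<circ> r) \<longlonglongrightarrow> (l, A)"
    by auto
  have l_lim: "(\<lambda>k. \<eta> (r k)) \<longlonglongrightarrow> l" and A_lim: "(\<lambda>k. B (\<tau> (r k))) \<longlonglongrightarrow> A"
    using tendsto_fst[OF lA(2)] tendsto_snd[OF lA(2)] by (auto simp: o_def)
  have x_lim': "(\<lambda>k. x (\<tau> (r k))) \<longlonglongrightarrow> y"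
    using LIMSEQ_subseq_LIMSEQ[OF x_lim r] by (simp add: o_def)
  show thesis
  proof
    show "A \<in> M" by (rule lA(1))
    show "l \<bullet> z \<le> v z" for z
      by (rule LIMSEQ_le_const2[OF tendsto_inner[OF l_lim tendsto_const]])
        (use \<eta>(2) in blast)
    have "(\<lambda>k. \<eta> (r k) \<bullet> x (\<tau> (r k))) \<longlonglongrightarrow> l \<bullet> y"
      by (intro tendsto_inner l_lim x_lim')
    then show "l \<bullet> y = 1"
      by (simp add: \<eta>(1) LIMSEQ_const_iff)
    have "(\<lambda>k. B (\<tau> (r k)) *v x (\<tau> (r k))) \<longlonglongrightarrow> A *v y"
      unfolding matrix_vector_mult_def
      by (intro tendsto_vec_lambda tendsto_sum tendsto_mult tendsto_vec_nth A_lim x_lim')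
    then have "(\<lambda>k. \<eta> (r k) \<bullet> (B (\<tau> (r k)) *v x (\<tau> (r k)))) \<longlonglongrightarrow> l \<bullet> (A *v y)"
      by (intro tendsto_inner l_lim)
    then show "l \<bullet> (A *v y) = 0"
      by (simp add: \<eta>(3) LIMSEQ_const_iff)
  qed
qed

theorem theorem5:
  fixes M :: "(real^'n^'n) set" and v :: "real^'n \<Rightarrow> real"
  assumes "C1_convex_compact_domain M"
    and "irreducible_matrices M"
    and "lyapunov_exponent M = 0"
    and "barabanov_norm M v"
  shows "\<not> (\<exists>a b. a \<noteq> b \<and> closed_segment a b \<subseteq> {x. v x = 1})"
proof
  assume "\<exists>a b. a \<noteq> b \<and> closed_segment a b \<subseteq> {x. v x = 1}"
  then obtain a b where ab: "a \<noteq> b" "closed_segment a b \<subseteq> {x. v x = 1}" by blast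
  then have v1: "v a = 1" "v b = 1" "v (midpoint a b) = 1"
    by (auto simp: subset_iff)
  have "compact M" using assms(1) by (simp add: C1_convex_compact_domain_def)
  then obtain l A where l: "\<And>z. l \<bullet> z \<le> v z" "l \<bullet> midpoint a b = 1"
    and A: "A \<in> M" "l \<bullet> (A *v midpoint a b) = 0"
    using barabanov_norm_extremal_pair[OF assms(4) _ v1(3)] by blast
  \<comment> \<open>Both terms are at most 1, so the hyperplane supporting the ball at the midpoint
    contains both ends.\<close>
  have "l \<bullet> a + l \<bullet> b = 2"
    using l(2) by (simp add: midpoint_def inner_add_right)
  with l(1)[of a] l(1)[of b] v1 have lab: "l \<bullet> a = 1" "l \<bullet> b = 1" by linarith+
  have le: "l \<bullet> (X *v a) \<le> 0" "l \<bullet> (X *v b) \<le> 0" if "X \<in> M" for X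
    using barabanov_norm_supporting_le[OF assms(4) that l(1)] lab v1 by auto
  have "l \<bullet> (A *v a) + l \<bullet> (A *v b) = 0"
    using A(2)
    by (simp add: midpoint_def matrix_vector_mult_scaleR matrix_vector_right_distrib inner_add_right)
  with le[OF A(1)] have eq: "l \<bullet> (A *v a) = 0" "l \<bullet> (A *v b) = 0" by linarith+
  \<comment> \<open>\<open>p c\<close> is the rank-one matrix with entries
    \<open>l $ i * c $ j\<close>; it represents the form \<open>l \<bullet> (X *v c)\<close> in the
    entrywise inner product.\<close>
  define p where "p c = (\<chi> i j. l $ i * c $ j)" for c :: "real^'n"
  have p: "p c \<bullet> X = l \<bullet> (X *v c)" for c and X :: "real^'n^'n"
    by (simp add: p_def inner_vec_def matrix_vector_mult_def sum_distrib_left mult_ac)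
  have support: "\<forall>X\<in>M. p a \<bullet> X \<le> p a \<bullet> A" "\<forall>X\<in>M. p b \<bullet> X \<le> p b \<bullet> A"
    using le eq by (auto simp: p)
  obtain i where "l $ i \<noteq> 0"
    using lab(1) by (metis inner_zero_left vec_eq_iff zero_index zero_neq_one)
  have nz: "p c \<noteq> 0" if c: "l \<bullet> c = 1" for c
  proof -
    obtain j where "c $ j \<noteq> 0"
      using c by (metis inner_zero_right vec_eq_iff zero_index zero_neq_one)
    then have "p c $ i $ j \<noteq> 0" using \<open>l $ i \<noteq> 0\<close> by (simp add: p_def)
    then show ?thesis by auto
  qed
  obtain g where "\<And>q. \<forall>X\<in>M. q \<bullet> X \<le> q \<bullet> A \<Longrightarrow> \<exists>c. q = c *\<^sub>R g"
    using C1_convex_compact_domain_normal[OF assms(1)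
        supporting_imp_frontier[OF A(1) nz[OF lab(1)] support(1)]] by blast
  with support obtain \<alpha> \<beta> where g: "p a = \<alpha> *\<^sub>R g" "p b = \<beta> *\<^sub>R g" by metis
  with nz lab have "\<beta> \<noteq> 0" by auto
  define \<mu> where "\<mu> = \<alpha> / \<beta>"
  have "p a = \<mu> *\<^sub>R p b" using g \<open>\<beta> \<noteq> 0\<close> by (simp add: \<mu>_def)
  \<comment> \<open>Row \<open>i\<close>, where \<open>l $ i\<close> is nonzero, recovers
    \<open>a\<close> and \<open>b\<close> from the rank-one matrices.\<close>
  then have "p a $ i $ j = (\<mu> *\<^sub>R p b) $ i $ j" for j by simp
  then have "l $ i * a $ j = \<mu> * (l $ i * b $ j)" for j by (simp add: p_def)
  then have "a = \<mu> *\<^sub>R b" using \<open>l $ i \<noteq> 0\<close> by (simp add: vec_eq_iff)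
  with lab have "\<mu> = 1" by simp
  with \<open>a = \<mu> *\<^sub>R b\<close> ab(1) show False by simp
qed

end
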